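(* Let $f:\mathbb{R}^n\to\bar{\mathbb{R}}:=\mathbb{R}\cup\{\infty\}$ and let $\mathcal C\subset\mathbb{R}^n$ be closed and convex. Let $\bar x\in\mathcal C$ and let $f$ be lower semi-continuous around $\bar x$. If $\bar x$ is a local solution of the problem $$\min f(x)\quad\text{such that }x\in\mathcal C,$$ then $$0\in\partial^p_{\mathcal C}f(\bar x)\subset\partial_{\mathcal C}f(\bar x).$$ Consequently, if $\mathcal C=\mathrm{dom}\,f$, then $0\in\bar\partial^pf(\bar x)\subset\bar\partial f(\bar x)$ whenever $\bar x$ is a local minimizer of $f$.
   Context: All spaces are Euclidean, with $\Vert(x,y)\Vert=\sqrt{\Vert x\Vert^2+\Vert y\Vert^2}$ on products; $\mathbb{B}(z,r)$ is the closed ball with center $z$ and radius $r$. For a set $S$, $\Pi(x,S)=\{u\in S\mid\Vert u-x\Vert=\inf_{v\in S}\Vert v-x\Vert\}$. $\mathrm{dom}\,f=\{x\mid f(x)<\infty\}$, $\mathrm{epi}\,f=\{(x,\alpha)\in\mathbb{R}^n\times\mathbb{R}\mid\alpha\ge f(x)\}$. "$f$ is lower semi-continuous around $\bar x$" means that there is $r_0>0$ such that $\mathrm{epi}\,f\cap\mathbb{B}((\bar x,f(\bar x)),r)$ is closed for all $r\in(0,r_0)$. A point $\bar x\in\mathrm{dom}\,f$ (with $\bar x\in\mathcal C$) is a local solution of $\min f(x)$ such that $x\in\mathcal C$ if there exists $r>0$ such that $f(\bar x)\le f(x)$ for all $x\in\mathcal C\cap\mathbb{B}(\bar x,r)$.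 When $\mathcal C=\mathrm{dom}\,f$, such an $\bar x$ is called a local minimizer of $f$. For a closed convex set $\mathcal K$ and $z\in\Omega\cap\mathcal K$, with $\Omega$ locally closed around $z$ (its intersection with every sufficiently small closed ball centered at $z$ is closed): $N^p_{\mathcal K}(z,\Omega)$ is the set of $z^*$ for which there is $t>0$ with $z+tz^*\in\mathcal K$ and $z\in\Pi(z+tz^*,\Omega\cap\mathcal K)$. $N_{\mathcal K}(z,\Omega)$ is the set of limits $z^*=\lim z_k^*$ with $z_k^*\in N^p_{\mathcal K}(z_k,\Omega)$, $z_k\in\Omega\cap\mathcal K$, $z_k\to z$. The proximal and limiting subdifferentials of $f$ at $\bar x\in\mathcal C\cap\mathrm{dom}\,f$ with respect to $\mathcal C$ are $\partial^p_{\mathcal C}f(\bar x)=\{x^*\mid(x^*,-1)\in N^p_{\mathcal C\times\mathbb{R}}((\bar x,f(\bar x)),\mathrm{epi}\,f)\}$ and $\partial_{\mathcal C}f(\bar x)=\{x^*\mid(x^*,-1)\in N_{\mathcal C\times\mathbb{R}}((\bar x,f(\bar x)),\mathrm{epi}\,f)\}$. When $\mathcal C=\mathrm{dom}\,f$ they are written $\bar\partial^pf(\bar x)$ and $\bar\partial f(\bar x)$. *)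

theory Defs
  imports "HOL-Analysis.Analysis"
begin

definition proj_set :: "'a::euclidean_space \<Rightarrow> 'a set \<Rightarrow> 'a set" where
  "proj_set x S = {u \<in> S. norm (u - x) = (INF v\<in>S. norm (v - x))}"

(* An extended real-valued function R^n -> R \<union> {\<infinity>} is modelled as an ereal-valued
   function; that -\<infinity> is not attained is a separate hypothesis wherever it is needed. *)

definition eff_dom :: "('a \<Rightarrow> ereal) \<Rightarrow> 'a set" where
  "eff_dom f = {x. f x < \<infinity>}"

definition epi :: "('a \<Rightarrow> ereal) \<Rightarrow> ('a \<times> real) set" where
  "epi f = {(x, \<alpha>). f x \<le> ereal \<alpha>}"

(* The point (x, f x) of the graph; meaningful only where f x is finite. *)
definition graph_pt :: "('a \<Rightarrow> ereal) \<Rightarrow> 'a \<Rightarrow> 'a \<times> real" where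
  "graph_pt f x = (x, real_of_ereal (f x))"

definition lsc_around :: "('a::euclidean_space \<Rightarrow> ereal) \<Rightarrow> 'a \<Rightarrow> bool" where
  "lsc_around f x \<longleftrightarrow> (\<exists>r0>0. \<forall>r. 0 < r \<and> r < r0 \<longrightarrow> closed (epi f \<inter> cball (graph_pt f x) r))"

definition local_solution :: "('a::euclidean_space \<Rightarrow> ereal) \<Rightarrow> 'a set \<Rightarrow> 'a \<Rightarrow> bool" where
  "local_solution f C x \<longleftrightarrow>
     x \<in> eff_dom f \<and> x \<in> C \<and> (\<exists>r>0. \<forall>y \<in> C \<inter> cball x r. f x \<le> f y)"

definition local_minimizer :: "('a::euclidean_space \<Rightarrow> ereal) \<Rightarrow> 'a \<Rightarrow> bool" where
  "local_minimizer f x \<longleftrightarrow> local_solution f (eff_dom f) x"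

(* Both normal cones are meant for K closed and convex, z in \<Omega> \<inter> K and \<Omega> locally closed
   around z. *)

definition prox_normal_cone :: "'a::euclidean_space set \<Rightarrow> 'a \<Rightarrow> 'a set \<Rightarrow> 'a set" where
  "prox_normal_cone K z \<Omega> =
     {zs. \<exists>t>0. z + t *\<^sub>R zs \<in> K \<and> z \<in> proj_set (z + t *\<^sub>R zs) (\<Omega> \<inter> K)}"

definition lim_normal_cone :: "'a::euclidean_space set \<Rightarrow> 'a \<Rightarrow> 'a set \<Rightarrow> 'a set" where
  "lim_normal_cone K z \<Omega> =
     {zs. \<exists>(Z :: nat \<Rightarrow> 'a) (Zs :: nat \<Rightarrow> 'a).
        (\<forall>k. Z k \<in> \<Omega> \<inter> K \<and> Zs k \<in> prox_normal_cone K (Z k) \<Omega>) \<and>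
        Z \<longlonglongrightarrow> z \<and> Zs \<longlonglongrightarrow> zs}"

(* Both subdifferentials are meant for x in C \<inter> eff_dom f. The ambient norm is that of the
   product 'a \<times> real, i.e. sqrt (norm x ^ 2 + norm y ^ 2). *)

definition prox_subdiff ::
    "'a::euclidean_space set \<Rightarrow> ('a \<Rightarrow> ereal) \<Rightarrow> 'a \<Rightarrow> 'a set" where
  "prox_subdiff C f x = {xs. (xs, -1) \<in> prox_normal_cone (C \<times> UNIV) (graph_pt f x) (epi f)}"

definition lim_subdiff ::
    "'a::euclidean_space set \<Rightarrow> ('a \<Rightarrow> ereal) \<Rightarrow> 'a \<Rightarrow> 'a set" where
  "lim_subdiff C f x = {xs. (xs, -1) \<in> lim_normal_cone (C \<times> UNIV) (graph_pt f x) (epi f)}"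

definition prox_subdiff_dom :: "('a::euclidean_space \<Rightarrow> ereal) \<Rightarrow> 'a \<Rightarrow> 'a set" where
  "prox_subdiff_dom f x = prox_subdiff (eff_dom f) f x"

definition lim_subdiff_dom :: "('a::euclidean_space \<Rightarrow> ereal) \<Rightarrow> 'a \<Rightarrow> 'a set" where
  "lim_subdiff_dom f x = lim_subdiff (eff_dom f) f x"

end

theory Submission
  imports Defs
begin

text \<open>
  Write \<open>\<mu>\<close> for the value of \<open>f\<close> at a local solution, minimal over the part of \<open>C\<close> in the ball of
  radius \<open>r\<close> around it. Lower the graph point by exactly \<open>r\<close>. In the epigraph over \<open>C\<close>, no point is
  nearer to the lowered point than the graph point: a point whose base lies in the ball has height
  at least \<open>\<mu>\<close>, so it is at least \<open>r\<close> above the lowered point, and a point whose base lies outside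
  the ball is already at horizontal distance more than \<open>r\<close>. Hence the vertical direction \<open>(0, -1)\<close>
  is a proximal normal, that is, \<open>0\<close> is a proximal subgradient (\<open>zero_in_prox_subdiff\<close>). That
  proximal normals are limiting normals is seen on constant sequences
  (\<open>prox_normal_cone_subset_lim\<close>).
\<close>

lemma proj_setI:
  assumes "u \<in> S" and "\<And>v. v \<in> S \<Longrightarrow> norm (u - x) \<le> norm (v - x)"
  shows "u \<in> proj_set x S"
proof -
  have "(INF v\<in>S. norm (v - x)) = norm (u - x)"
    using assms by (intro cInf_eq_minimum) auto
  with assms(1) show ?thesis
    by (simp add: proj_set_def)
qed

text \<open>
  A point with a proximal normal is a projection onto \<open>\<Omega> \<inter> K\<close>, hence lies in \<open>\<Omega> \<inter> K\<close>, so that the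
  constant sequences at the point and at the normal are admissible for the limiting cone.
\<close>
lemma prox_normal_cone_subset_lim: "prox_normal_cone K z \<Omega> \<subseteq> lim_normal_cone K z \<Omega>"
proof
  fix zs assume zs: "zs \<in> prox_normal_cone K z \<Omega>"
  then have "z \<in> \<Omega> \<inter> K"
    by (auto simp: prox_normal_cone_def proj_set_def)
  with zs show "zs \<in> lim_normal_cone K z \<Omega>"
    unfolding lim_normal_cone_def
    by (intro CollectI exI[of _ "\<lambda>_. z"] exI[of _ "\<lambda>_. zs"]) simp
qed

lemma prox_subdiff_subset_lim: "prox_subdiff C f x \<subseteq> lim_subdiff C f x"
  using prox_normal_cone_subset_lim by (auto simp: prox_subdiff_def lim_subdiff_def)

text \<open>
  The witness for the proximal normal is the step \<open>t = r\<close>: a longer one could bring points outside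
  the ball, where \<open>f\<close> is not controlled, closer to the lowered point than the graph point is.
\<close>
lemma zero_in_prox_subdiff:
  fixes f :: "'a::euclidean_space \<Rightarrow> ereal"
  assumes "f x \<noteq> -\<infinity>" and "local_solution f C x"
  shows "0 \<in> prox_subdiff C f x"
proof -
  obtain r where "x \<in> C" "f x < \<infinity>" "r > 0" and min: "\<And>y. y \<in> C \<inter> cball x r \<Longrightarrow> f x \<le> f y"
    using assms(2) by (auto simp: local_solution_def eff_dom_def)
  obtain \<mu> where \<mu>: "f x = ereal \<mu>"
    using assms(1) \<open>f x < \<infinity>\<close> by (cases "f x") auto
  have "(x, \<mu>) \<in> proj_set (x, \<mu> - r) (epi f \<inter> C \<times> UNIV)"
  proof (rule proj_setI)
    show "(x, \<mu>) \<in> epi f \<inter> C \<times> UNIV"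
      using \<open>x \<in> C\<close> \<mu> by (simp add: epi_def)
  next
    fix v assume "v \<in> epi f \<inter> C \<times> UNIV"
    then obtain y \<alpha> where v: "v = (y, \<alpha>)" "f y \<le> ereal \<alpha>" "y \<in> C"
      by (auto simp: epi_def)
    have "r \<le> norm (v - (x, \<mu> - r))"
    proof (cases "y \<in> cball x r")
      case True
      then have "ereal \<mu> \<le> ereal \<alpha>"
        using min[of y] v \<mu> by (metis IntI order_trans)
      then have "r \<le> norm (\<alpha> - (\<mu> - r))"
        by simp
      also have "\<dots> \<le> norm (v - (x, \<mu> - r))"
        using norm_snd_le[of "\<alpha> - (\<mu> - r)" "y - x"] v by simp
      finally show ?thesis .
    next
      case False
      then have "r \<le> norm (y - x)"
        by (simp add: dist_norm norm_minus_commute)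
      also have "\<dots> \<le> norm (v - (x, \<mu> - r))"
        using norm_fst_le[of "y - x" "\<alpha> - (\<mu> - r)"] v by simp
      finally show ?thesis .
    qed
    then show "norm ((x, \<mu>) - (x, \<mu> - r)) \<le> norm (v - (x, \<mu> - r))"
      using \<open>r > 0\<close> by (simp add: norm_Pair)
  qed
  moreover have "(x, \<mu>) + r *\<^sub>R (0, -1) = (x, \<mu> - r)"
    by simp
  ultimately show ?thesis
    using \<open>r > 0\<close> \<open>x \<in> C\<close> \<mu>
    by (auto simp: prox_subdiff_def prox_normal_cone_def graph_pt_def intro!: exI[of _ r])
qed

theorem theorem10:
  fixes f :: "real ^ 'n \<Rightarrow> ereal" and C :: "(real ^ 'n) set" and xbar :: "real ^ 'n"
  assumes "\<And>x. f x \<noteq> -\<infinity>"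
    and "closed C" and "convex C"
    and "xbar \<in> C"
    and "lsc_around f xbar"
  shows "(local_solution f C xbar \<longrightarrow>
            0 \<in> prox_subdiff C f xbar \<and> prox_subdiff C f xbar \<subseteq> lim_subdiff C f xbar) \<and>
         (C = eff_dom f \<and> local_minimizer f xbar \<longrightarrow>
            0 \<in> prox_subdiff_dom f xbar \<and> prox_subdiff_dom f xbar \<subseteq> lim_subdiff_dom f xbar)"
  using zero_in_prox_subdiff[of f xbar] assms(1) prox_subdiff_subset_lim
  unfolding local_minimizer_def prox_subdiff_dom_def lim_subdiff_dom_def by blast

end
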